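(* As formal power series, $$\sum_{n\ge 0}t^nH_n(x)=\frac{1}{1-t-xt-xt^2}.$$
   Context: Fix a ground field $F$. For $n\ge 0$, $ch(P_n)$ denotes the associative unital $F$-algebra with generators $v_1,\dots,v_n,e_{1,2},e_{2,3},\dots,e_{n-1,n}$ and the following relations: all $v_i$ commute with each other, and each $e_{i,i+1}$ commutes with every generator except $e_{i-1,i}$, $e_{i+1,i+2}$, $v_i$, $v_{i+1}$ (no relation is imposed between $e_{i,i+1}$ and these). For $n=0$ there are no generators and the algebra is $F$. For a quadratic algebra $A=T(V)/(R)$ with $V$ finite-dimensional and $R\subseteq V\otimes V$, the dual algebra is $A^*=T(V^* )/(R^\perp)$, where $R^\perp\subseteq V^*\otimes V^*\cong(V\otimes V)^*$ is the annihilator of $R$. It is graded with generators in degree $1$. $H_n(x)=\sum_{i\ge0}H_n^ix^i$ is the Hilbert series of $ch(P_n)^*$, i.e. $H_n^i=\dim (ch(P_n)^* )_i$. *)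

theory Defs
  imports
    "HOL-Algebra.QuotRing"
    "HOL-Algebra.Embedded_Algebras"
    "HOL-Library.Poly_Mapping"
    "HOL-Computational_Algebra.Formal_Power_Series"
begin

text \<open>
  Words over \<open>'x\<close> form the free monoid, written additively so that the convolution product of
  \<^theory>\<open>HOL-Library.Poly_Mapping\<close> turns \<open>'x list \<Rightarrow>\<^sub>0 'f\<close> into the free associative unital
  algebra on \<open>'x\<close>, with \<^term>\<open>Poly_Mapping.single [] c\<close> as the scalar \<open>c\<close>.
\<close>

instantiation list :: (type) monoid_add
begin

definition zero_list :: "'a list" where "0 = []"
definition plus_list :: "'a list \<Rightarrow> 'a list \<Rightarrow> 'a list" where "xs + ys = xs @ ys"

instance by standard (simp_all add: zero_list_def plus_list_def)

end

definition scalar :: "'f::field \<Rightarrow> ('x list \<Rightarrow>\<^sub>0 'f)"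
  where "scalar c = Poly_Mapping.single [] c"

text \<open>The tensor algebra \<open>T(V)\<close> of the vector space \<open>V\<close> with basis \<open>X\<close>, and its degree \<open>d\<close> part.\<close>

definition tensor_algebra :: "'x set \<Rightarrow> ('x list \<Rightarrow>\<^sub>0 'f::field) ring"
  where "tensor_algebra X =
    \<lparr>carrier = {p. \<forall>w\<in>Poly_Mapping.keys p. set w \<subseteq> X}, monoid.mult = (*), one = 1, zero = 0, add = (+)\<rparr>"

definition tensor_power :: "'x set \<Rightarrow> nat \<Rightarrow> ('x list \<Rightarrow>\<^sub>0 'f::field) set"
  where "tensor_power X d = {p. \<forall>w\<in>Poly_Mapping.keys p. set w \<subseteq> X \<and> length w = d}"

text \<open>
  A quadratic algebra \<open>T(V)/(R)\<close> is given by a basis \<open>gens\<close> of \<open>V\<close> and the subspace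
  \<open>rels\<close> \<open>= R\<close> of \<open>V \<otimes> V\<close>.
\<close>

record (overloaded) ('x, 'f::field) quadratic_data =
  gens :: "'x set"
  rels :: "('x list \<Rightarrow>\<^sub>0 'f) set"

definition rel_ideal :: "('x, 'f::field) quadratic_data \<Rightarrow> ('x list \<Rightarrow>\<^sub>0 'f) set"
  where "rel_ideal A = Idl\<^bsub>tensor_algebra (gens A)\<^esub> (rels A)"

definition quadratic_algebra :: "('x, 'f::field) quadratic_data \<Rightarrow> ('x list \<Rightarrow>\<^sub>0 'f) set ring"
  where "quadratic_algebra A = tensor_algebra (gens A) Quot rel_ideal A"

definition residue_class ::
    "('x, 'f::field) quadratic_data \<Rightarrow> ('x list \<Rightarrow>\<^sub>0 'f) \<Rightarrow> ('x list \<Rightarrow>\<^sub>0 'f) set"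
  where "residue_class A p = rel_ideal A +>\<^bsub>tensor_algebra (gens A)\<^esub> p"

definition graded_part :: "('x, 'f::field) quadratic_data \<Rightarrow> nat \<Rightarrow> ('x list \<Rightarrow>\<^sub>0 'f) set set"
  where "graded_part A d = residue_class A ` tensor_power (gens A) d"

text \<open>The copy of the ground field inside the quotient algebra, over which dimensions are taken.\<close>

definition ground_field :: "('x, 'f::field) quadratic_data \<Rightarrow> ('x list \<Rightarrow>\<^sub>0 'f) set set"
  where "ground_field A = residue_class A ` range scalar"

definition hilbert_coeff :: "('x, 'f::field) quadratic_data \<Rightarrow> nat \<Rightarrow> nat"
  where "hilbert_coeff A d = ring.dim (quadratic_algebra A) (ground_field A) (graded_part A d)"

definition hilbert_series :: "('x, 'f::field) quadratic_data \<Rightarrow> rat fps"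
  where "hilbert_series A = Abs_fps (\<lambda>d. of_nat (hilbert_coeff A d))"

text \<open>
  \<open>V\<^sup>*\<close> is written in the basis dual to \<open>gens\<close>, using the same index set. Under
  \<open>V\<^sup>* \<otimes> V\<^sup>* \<cong> (V \<otimes> V)\<^sup>*\<close>, \<open>(f \<otimes> g)(v \<otimes> w) = f v * g w\<close>, words of length two
  are then dual to themselves, so evaluating \<open>s\<close> on \<open>r\<close> is the coefficientwise pairing.
\<close>

definition pairing :: "('x list \<Rightarrow>\<^sub>0 'f::field) \<Rightarrow> ('x list \<Rightarrow>\<^sub>0 'f) \<Rightarrow> 'f"
  where "pairing s r = (\<Sum>w\<in>Poly_Mapping.keys s. Poly_Mapping.lookup s w * Poly_Mapping.lookup r w)"

definition quadratic_dual :: "('x, 'f::field) quadratic_data \<Rightarrow> ('x, 'f) quadratic_data"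
  where "quadratic_dual A =
    \<lparr>gens = gens A, rels = {s \<in> tensor_power (gens A) 2. \<forall>r\<in>rels A. pairing s r = 0}\<rparr>"

text \<open>\<open>E i\<close> stands for the edge generator \<open>e\<^bsub>i,i+1\<^esub>\<close>.\<close>

datatype path_gen = V nat | E nat

definition path_gens :: "nat \<Rightarrow> path_gen set"
  where "path_gens n = {V i |i. 1 \<le> i \<and> i \<le> n} \<union> {E i |i. 1 \<le> i \<and> i + 1 \<le> n}"

fun commuting :: "path_gen \<Rightarrow> path_gen \<Rightarrow> bool" where
  "commuting (V i) (V j) \<longleftrightarrow> True"
| "commuting (E i) (V j) \<longleftrightarrow> j \<noteq> i \<and> j \<noteq> i + 1"
| "commuting (V j) (E i) \<longleftrightarrow> j \<noteq> i \<and> j \<noteq> i + 1"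
| "commuting (E i) (E j) \<longleftrightarrow> j + 1 \<noteq> i \<and> j \<noteq> i + 1"

definition ch_path :: "nat \<Rightarrow> (path_gen, 'f::field) quadratic_data"
  where "ch_path n =
    \<lparr>gens = path_gens n,
     rels = module.span (\<lambda>c p. scalar c * p)
       {Poly_Mapping.single [a, b] 1 - Poly_Mapping.single [b, a] 1 |a b.
          a \<in> path_gens n \<and> b \<in> path_gens n \<and> commuting a b}\<rparr>"

lemma vector_space_scalar:
  "vector_space (\<lambda>(c::'f::field) (p :: 'x list \<Rightarrow>\<^sub>0 'f). scalar c * p)"
proof
  fix c d :: 'f and p q :: "'x list \<Rightarrow>\<^sub>0 'f"
  show "scalar c * (p + q) = scalar c * p + scalar c * q"
    by (rule distrib_left)
  show "scalar (c + d) * p = scalar c * p + scalar d * p"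
    by (simp only: scalar_def single_add distrib_right)
  have "scalar c * scalar d = (scalar (c * d) :: 'x list \<Rightarrow>\<^sub>0 'f)"
    by (simp only: scalar_def mult_single plus_list_def append_Nil)
  then show "scalar c * (scalar d * p) = scalar (c * d) * p"
    by (simp only: mult.assoc[symmetric])
  show "scalar 1 * p = p"
    by (simp only: scalar_def zero_list_def[symmetric] single_one mult_1_left)
qed

lemma ring_tensor_algebra: "ring (tensor_algebra X :: ('x list \<Rightarrow>\<^sub>0 'f::field) ring)"
proof (rule ringI)
  let ?T = "tensor_algebra X :: ('x list \<Rightarrow>\<^sub>0 'f) ring"
  have add: "Poly_Mapping.keys (p + q) \<subseteq> Poly_Mapping.keys p \<union> Poly_Mapping.keys q"
    for p q :: "'x list \<Rightarrow>\<^sub>0 'f" by (rule Poly_Mapping.keys_add)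
  show "abelian_group ?T"
  proof (rule abelian_groupI)
    fix p q assume "p \<in> carrier ?T" "q \<in> carrier ?T"
    then show "p \<oplus>\<^bsub>?T\<^esub> q \<in> carrier ?T"
      using add[of p q] by (auto simp: tensor_algebra_def)
  next
    fix p assume "p \<in> carrier ?T"
    then show "\<exists>q\<in>carrier ?T. q \<oplus>\<^bsub>?T\<^esub> p = \<zero>\<^bsub>?T\<^esub>"
      by (intro bexI[of _ "- p"]) (auto simp: tensor_algebra_def)
  qed (auto simp: tensor_algebra_def add.assoc add.commute)
  show "Group.monoid ?T"
  proof (rule monoidI)
    fix p q assume pq: "p \<in> carrier ?T" "q \<in> carrier ?T"
    show "p \<otimes>\<^bsub>?T\<^esub> q \<in> carrier ?T"
      using pq Poly_Mapping.keys_mult[of p q]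
      by (fastforce simp: tensor_algebra_def plus_list_def)
  next
    show "\<one>\<^bsub>?T\<^esub> \<in> carrier ?T"
      by (auto simp: tensor_algebra_def zero_list_def)
  qed (auto simp: tensor_algebra_def mult.assoc)
qed (auto simp: tensor_algebra_def algebra_simps)

end

theory Submission
  imports Defs
begin

text \<open>
  In the dual algebra every generator squares to zero, commuting generators anticommute, and
  products of non-commuting generators vanish: it is an exterior algebra modulo the products of
  non-commuting pairs. Sorting words shows that it is spanned by the increasing words on sets of
  pairwise commuting generators. These words are independent, because the functional sending a word
  to the sign of the permutation sorting it, and words on any other set to zero, kills all relations.
  Hence \<open>H\<^sub>n\<close> is the generating polynomial of the sets of pairwise commuting generators of the
  path. Distinguishing whether such a set contains \<open>v\<^bsub>n+2\<^esub>\<close>, contains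
  \<open>e\<^bsub>n+1,n+2\<^esub>\<close>, or neither gives \<open>H\<^bsub>n+2\<^esub> = (1 + x) H\<^bsub>n+1\<^esub> + x H\<^sub>n\<close>.
\<close>

subsection \<open>Functionals on the free algebra\<close>

lemma poly_mapping_sum_single:
  "p = (\<Sum>w\<in>Poly_Mapping.keys p. Poly_Mapping.single w (Poly_Mapping.lookup p w))"
  by (rule poly_mapping_eqI)
    (auto simp: lookup_sum lookup_single when_def sum.delta in_keys_iff cong: if_cong)

lemma single_mult_single:
  "Poly_Mapping.single u c * Poly_Mapping.single v d = Poly_Mapping.single (u @ v) (c * d :: 'f::field)"
  by (simp add: mult_single plus_list_def)

text \<open>The linear extension of \<open>f\<close> from the words, which form a basis of the free
  algebra.\<close>

definition word_functional :: "('x list \<Rightarrow> 'f::field) \<Rightarrow> ('x list \<Rightarrow>\<^sub>0 'f) \<Rightarrow> 'f"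
  where "word_functional f p = (\<Sum>w\<in>Poly_Mapping.keys p. Poly_Mapping.lookup p w * f w)"

lemma word_functional_superset:
  assumes "finite B" "Poly_Mapping.keys p \<subseteq> B"
  shows "word_functional f p = (\<Sum>w\<in>B. Poly_Mapping.lookup p w * f w)"
  unfolding word_functional_def
  by (rule sum.mono_neutral_left) (use assms in \<open>auto simp: in_keys_iff\<close>)

lemma word_functional_0 [simp]: "word_functional f 0 = 0"
  by (simp add: word_functional_def)

lemma word_functional_single [simp]: "word_functional f (Poly_Mapping.single w c) = c * f w"
  by (subst word_functional_superset[of "{w}"]) auto

lemma word_functional_add:
  "word_functional f (p + q) = word_functional f p + word_functional f q"
proof -
  let ?B = "Poly_Mapping.keys p \<union> Poly_Mapping.keys q"
  have "word_functional f r = (\<Sum>w\<in>?B. Poly_Mapping.lookup r w * f w)" if "Poly_Mapping.keys r \<subseteq> ?B" for r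
    by (rule word_functional_superset) (use that in auto)
  then show ?thesis
    using Poly_Mapping.keys_add[of p q]
    by (simp add: lookup_add distrib_right sum.distrib)
qed

lemma word_functional_uminus: "word_functional f (- p) = - word_functional f p"
  using word_functional_add[of f p "- p"] by (simp add: eq_neg_iff_add_eq_0 add.commute)

lemma word_functional_diff:
  "word_functional f (p - q) = word_functional f p - word_functional f q"
  using word_functional_add[of f p "- q"] by (simp add: word_functional_uminus)

lemma word_functional_sum:
  "word_functional f (\<Sum>i\<in>A. p i) = (\<Sum>i\<in>A. word_functional f (p i))"
  by (induction A rule: infinite_finite_induct) (auto simp: word_functional_add)

text \<open>Expanding \<open>q\<close> into words moves each of them into the argument of
  \<open>f\<close>, so a functional on a product becomes a combination of translated functionals on
  \<open>p\<close>. This is used to test membership in ideals.\<close>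

lemma word_functional_mult_left:
  "word_functional f (q * p) =
    (\<Sum>a\<in>Poly_Mapping.keys q. Poly_Mapping.lookup q a * word_functional (\<lambda>b. f (a @ b)) p)"
proof -
  have "q * p = (\<Sum>a\<in>Poly_Mapping.keys q. Poly_Mapping.single a (Poly_Mapping.lookup q a))
      * (\<Sum>b\<in>Poly_Mapping.keys p. Poly_Mapping.single b (Poly_Mapping.lookup p b))"
    by (rule arg_cong2[OF poly_mapping_sum_single poly_mapping_sum_single])
  also have "\<dots> = (\<Sum>a\<in>Poly_Mapping.keys q. \<Sum>b\<in>Poly_Mapping.keys p.
      Poly_Mapping.single (a @ b) (Poly_Mapping.lookup q a * Poly_Mapping.lookup p b))"
    by (subst sum_product) (simp only: single_mult_single)
  finally have "word_functional f (q * p) = (\<Sum>a\<in>Poly_Mapping.keys q. \<Sum>b\<in>Poly_Mapping.keys p.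
      Poly_Mapping.lookup q a * Poly_Mapping.lookup p b * f (a @ b))"
    by (simp only: word_functional_sum word_functional_single)
  then show ?thesis
    by (simp only: word_functional_def[of _ p] sum_distrib_left mult.assoc)
qed

lemma word_functional_mult_right:
  "word_functional f (q * p) =
    (\<Sum>b\<in>Poly_Mapping.keys p. Poly_Mapping.lookup p b * word_functional (\<lambda>a. f (a @ b)) q)"
  unfolding word_functional_mult_left
  by (simp add: word_functional_def sum_distrib_left, subst sum.swap) (simp add: mult_ac)

subsection \<open>The inversion sign\<close>

text \<open>For symmetric \<open>comm\<close>, this is the sign of the permutation sorting a word of
  distinct, pairwise commuting letters, and 0 on every other word: the head \<open>a\<close>
  contributes one inversion for each smaller letter behind it.\<close>

fun exterior_sign :: "('x::linorder \<Rightarrow> 'x \<Rightarrow> bool) \<Rightarrow> 'x list \<Rightarrow> 'f::field" where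
  "exterior_sign comm [] = 1"
| "exterior_sign comm (a # w) =
    (if a \<in> set w \<or> (\<exists>b\<in>set w. \<not> comm a b) then 0
     else (- 1) ^ card {b \<in> set w. b < a} * exterior_sign comm w)"

context
  fixes comm :: "'x::linorder \<Rightarrow> 'x \<Rightarrow> bool"
  assumes comm_sym: "comm a b \<Longrightarrow> comm b a"
begin

text \<open>The zero test at each letter looks only at the letters behind it; symmetry of
  \<open>comm\<close> makes this cover all pairs.\<close>

lemma exterior_sign_nonzero:
  "exterior_sign comm w \<noteq> (0::'f::field) \<longleftrightarrow> distinct w \<and> pairwise comm (set w)"
proof (induction w)
  case (Cons a w)
  have "(\<forall>b. b \<in> set w \<and> b \<noteq> a \<longrightarrow> comm a b \<and> comm b a) \<longleftrightarrow> (\<forall>b. b \<in> set w \<and> b \<noteq> a \<longrightarrow> comm a b)"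
    using comm_sym by blast
  then show ?case
    using Cons by (auto simp: pairwise_insert)
qed simp

lemma exterior_sign_sorted:
  assumes "sorted w" "distinct w" "pairwise comm (set w)"
  shows "exterior_sign comm w = (1::'f::field)"
  using assms
proof (induction w)
  case (Cons a w)
  then have "{b \<in> set w. b < a} = {}" by auto
  then show ?case using Cons by (auto simp only: exterior_sign.simps) (auto simp: pairwise_insert)
qed simp

text \<open>Exchanging neighbours changes the number of inversions by one, unless both signs vanish.
  Letters further left see only the set of letters behind them, which stays the same.\<close>

lemma exterior_sign_swap:
  assumes "comm a b" "a \<noteq> b"
  shows "exterior_sign comm (u @ a # b # v) = (- exterior_sign comm (u @ b # a # v) :: 'f::field)"
proof (induction u)
  case Nil
  have *: "exterior_sign comm (a # b # v) = (- exterior_sign comm (b # a # v) :: 'f)"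
    if "comm a b" "a < b" for a b :: 'x
  proof (cases "a \<in> set v \<or> b \<in> set v \<or> (\<exists>c\<in>set v. \<not> comm a c \<or> \<not> comm b c)")
    case True
    then show ?thesis using that comm_sym[of a b] by auto
  next
    case False
    \<comment> \<open>In \<open>b # a # v\<close> the letter \<open>b\<close> has the smaller letter
      \<open>a\<close> behind it, which is the one additional inversion.\<close>
    have "{c. (c = b \<or> c \<in> set v) \<and> c < a} = {c \<in> set v. c < a}"
      "{c. (c = a \<or> c \<in> set v) \<and> c < b} = insert a {c \<in> set v. c < b}"
      using \<open>a < b\<close> by auto
    then show ?thesis using that False comm_sym[of a b] by auto
  qed
  show ?case
    using assms *[of a b] *[of b a] comm_sym[of a b] by (cases "a < b") auto
next
  case (Cons c u)
  have "set (u @ a # b # v) = set (u @ b # a # v)" by auto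
  then show ?case using Cons.IH by (simp only: append_Cons exterior_sign.simps) simp
qed

lemma exterior_sign_eq_0:
  assumes "a = b \<or> \<not> comm a b"
  shows "exterior_sign comm (u @ a # b # v) = (0::'f::field)"
  using assms by (induction u) auto

text \<open>The coefficients of \<open>r\<close> are symmetric on commuting pairs while the sign is
  antisymmetric, so these terms cancel; squares and non-commuting pairs have sign 0. The context
  \<open>u\<close>, \<open>v\<close> provides the two-sided translates needed for ideals.\<close>

lemma word_functional_relation_eq_0:
  fixes r :: "'x list \<Rightarrow>\<^sub>0 'f::field"
  assumes X: "finite X"
    and r: "r \<in> tensor_power X 2"
    and sym: "\<And>a b. a \<in> X \<Longrightarrow> b \<in> X \<Longrightarrow> comm a b \<Longrightarrow>
      Poly_Mapping.lookup r [a, b] = Poly_Mapping.lookup r [b, a]"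
  shows "word_functional (\<lambda>w. if set (u @ w @ v) = S then exterior_sign comm (u @ w @ v) else 0) r = 0"
proof -
  let ?f = "\<lambda>w. if set (u @ w @ v) = S then exterior_sign comm (u @ w @ v) else (0::'f)"
  let ?g = "\<lambda>(a, b). Poly_Mapping.lookup r [a, b] * ?f [a, b]"
  let ?L = "{(a, b). a \<in> X \<and> b \<in> X \<and> a < b}"
  let ?G = "{(a, b). a \<in> X \<and> b \<in> X \<and> b < a}"
  let ?D = "{(a, b). a \<in> X \<and> b \<in> X \<and> a = b}"
  have fin: "finite ?L" "finite ?G" "finite ?D"
    by (rule finite_subset[OF _ finite_cartesian_product[OF X X]], auto)+
  have "Poly_Mapping.keys r \<subseteq> (\<lambda>(a, b). [a, b]) ` (X \<times> X)"
    using r by (fastforce simp: tensor_power_def length_Suc_conv numeral_2_eq_2)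
  then have "word_functional ?f r = (\<Sum>w\<in>(\<lambda>(a, b). [a, b]) ` (X \<times> X). Poly_Mapping.lookup r w * ?f w)"
    using X by (intro word_functional_superset) auto
  also have "\<dots> = sum ?g (X \<times> X)"
    by (subst sum.reindex) (auto simp: inj_on_def case_prod_unfold)
  also have "X \<times> X = (?L \<union> ?G) \<union> ?D" by auto
  also have "sum ?g \<dots> = sum ?g ?L + sum ?g ?G + sum ?g ?D"
    using fin by (subst sum.union_disjoint, simp, simp, force, subst sum.union_disjoint) auto
  \<comment> \<open>Swapping the coordinates carries \<open>?G\<close> onto \<open>?L\<close>, so
    that each pair meets its reversal.\<close>
  also have "sum ?g ?G = (\<Sum>(a, b)\<in>?L. Poly_Mapping.lookup r [b, a] * ?f [b, a])"
    by (rule sum.reindex_bij_witness[of _ prod.swap prod.swap]) auto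
  also have "sum ?g ?L = - \<dots>"
  proof (subst sum_negf[symmetric], rule sum.cong[OF refl], clarify)
    fix a b assume ab: "a \<in> X" "b \<in> X" "a < b"
    have S: "set (u @ [a, b] @ v) = set (u @ [b, a] @ v)" by auto
    show "Poly_Mapping.lookup r [a, b] * ?f [a, b] = - (Poly_Mapping.lookup r [b, a] * ?f [b, a])"
    proof (cases "comm a b")
      case True
      then show ?thesis
        using sym[of a b] exterior_sign_swap[OF True, of u v, where ?'f = 'f] ab S by simp
    next
      case False
      then show ?thesis
        using exterior_sign_eq_0[of a b u v, where ?'f = 'f]
          exterior_sign_eq_0[of b a u v, where ?'f = 'f] comm_sym[of b a] by auto
    qed
  qed
  also have "sum ?g ?D = 0"
    using exterior_sign_eq_0[of _ _ u v, where ?'f = 'f] by (intro sum.neutral) auto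
  finally show ?thesis by simp
qed

end

subsection \<open>Exterior algebras modulo non-commuting pairs\<close>

lemma lookup_single_if:
  "Poly_Mapping.lookup (Poly_Mapping.single w c) v = (if w = v then c else 0)"
  by (simp add: lookup_single when_def)

lemma single_Nil_one [simp]: "Poly_Mapping.single [] (1::'f::field) = 1"
  using single_one[where ?'a = "'x list" and ?'b = 'f] by (simp add: zero_list_def)

section \<open>Ring operations of the tensor algebra\<close>

lemma tensor_algebra_carrier_iff:
  "p \<in> carrier (tensor_algebra X) \<longleftrightarrow> (\<forall>w\<in>Poly_Mapping.keys p. set w \<subseteq> X)"
  by (simp add: tensor_algebra_def)

lemma tensor_algebra_mult [simp]: "p \<otimes>\<^bsub>tensor_algebra X\<^esub> q = p * q"
  and tensor_algebra_add [simp]: "p \<oplus>\<^bsub>tensor_algebra X\<^esub> q = p + q"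
  and tensor_algebra_one [simp]: "\<one>\<^bsub>tensor_algebra X\<^esub> = 1"
  and tensor_algebra_zero [simp]: "\<zero>\<^bsub>tensor_algebra X\<^esub> = 0"
  by (simp_all add: tensor_algebra_def)

lemma zero_in_tensor_algebra [simp]: "0 \<in> carrier (tensor_algebra X)"
  and single_in_tensor_algebra [simp]:
    "set w \<subseteq> X \<Longrightarrow> Poly_Mapping.single w c \<in> carrier (tensor_algebra X)"
  by (simp_all add: tensor_algebra_carrier_iff)

lemma tensor_algebra_a_inv:
  assumes "p \<in> carrier (tensor_algebra X)"
  shows "\<ominus>\<^bsub>tensor_algebra X\<^esub> p = - p"
proof -
  interpret ring "tensor_algebra X" by (rule ring_tensor_algebra)
  show ?thesis
    by (rule minus_equality) (use assms in \<open>auto simp: tensor_algebra_carrier_iff\<close>)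
qed

lemma tensor_algebra_a_minus:
  assumes "q \<in> carrier (tensor_algebra X)"
  shows "p \<ominus>\<^bsub>tensor_algebra X\<^esub> q = p - q"
  using tensor_algebra_a_inv[OF assms] by (simp add: a_minus_def)

text \<open>
  The relation \<open>comm\<close> matters only off the diagonal: the condition on \<open>s\<close> is void for \<open>a = b\<close>, so
  squares of generators are relations in any case.
\<close>

locale partially_commuting_exterior =
  fixes A :: "('x::linorder, 'f::field) quadratic_data" and comm :: "'x \<Rightarrow> 'x \<Rightarrow> bool"
  assumes finite_gens: "finite (gens A)"
    and comm_sym: "comm a b \<Longrightarrow> comm b a"
    and rels_eq: "rels A = {s \<in> tensor_power (gens A) 2. \<forall>a\<in>gens A. \<forall>b\<in>gens A.
      comm a b \<longrightarrow> Poly_Mapping.lookup s [a, b] = Poly_Mapping.lookup s [b, a]}"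
begin

abbreviation tensors :: "('x list \<Rightarrow>\<^sub>0 'f) ring"
  where "tensors \<equiv> tensor_algebra (gens A)"

text \<open>The coefficient of the increasing word on \<open>S\<close> in a normal form; fixing the
  letter set separates distinct increasing words.\<close>

definition coord :: "'x set \<Rightarrow> 'x list \<Rightarrow> 'f"
  where "coord S w = (if set w = S then exterior_sign comm w else 0)"

section \<open>The ideal of relations and the functionals vanishing on it\<close>

lemma rels_subset: "rels A \<subseteq> carrier tensors"
  by (auto simp: rels_eq tensor_power_def tensor_algebra_carrier_iff)

lemma ideal_rel_ideal: "ideal (rel_ideal A) tensors"
  unfolding rel_ideal_def
  by (rule ring.genideal_ideal[OF ring_tensor_algebra rels_subset])

lemma rel_ideal_zero: "0 \<in> rel_ideal A"
  using additive_subgroup.zero_closed[OF ideal.axioms(1)[OF ideal_rel_ideal]] by simp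

lemma rel_ideal_add: "p \<in> rel_ideal A \<Longrightarrow> q \<in> rel_ideal A \<Longrightarrow> p + q \<in> rel_ideal A"
  using additive_subgroup.a_closed[OF ideal.axioms(1)[OF ideal_rel_ideal], of p q] by simp

lemma rel_ideal_sum:
  "(\<And>i. i \<in> J \<Longrightarrow> p i \<in> rel_ideal A) \<Longrightarrow> (\<Sum>i\<in>J. p i) \<in> rel_ideal A"
  by (induction J rule: infinite_finite_induct) (auto simp: rel_ideal_zero rel_ideal_add)

lemma rel_ideal_mult_left:
  "p \<in> rel_ideal A \<Longrightarrow> q \<in> carrier tensors \<Longrightarrow> q * p \<in> rel_ideal A"
  using ideal.I_l_closed[OF ideal_rel_ideal, of p q] by simp

lemma rel_ideal_mult_right:
  "p \<in> rel_ideal A \<Longrightarrow> q \<in> carrier tensors \<Longrightarrow> p * q \<in> rel_ideal A"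
  using ideal.I_r_closed[OF ideal_rel_ideal, of p q] by simp

lemma rels_in_rel_ideal: "rels A \<subseteq> rel_ideal A"
  unfolding rel_ideal_def by (rule ring.genideal_self[OF ring_tensor_algebra rels_subset])

text \<open>Lets each coordinate descend to the quotient, where it serves to prove
  independence.\<close>

lemma word_functional_coord_rel_ideal:
  assumes "p \<in> rel_ideal A"
  shows "word_functional (coord S) p = 0"
proof -
  \<comment> \<open>Vanishing of all two-sided translates, unlike that of the functional alone, defines an ideal.\<close>
  define K where "K = {p \<in> carrier tensors. \<forall>u v. word_functional (\<lambda>w. coord S (u @ w @ v)) p = 0}"
  interpret T: ring tensors by (rule ring_tensor_algebra)
  have "ideal K tensors"
  proof (rule idealI)
    show "ring tensors" by (rule ring_tensor_algebra)
    show "subgroup K (add_monoid tensors)"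
    proof (rule T.add.subgroupI)
      show "K \<subseteq> carrier tensors" by (auto simp: K_def)
      have "0 \<in> K" by (auto simp: K_def)
      then show "K \<noteq> {}" by blast
      fix p assume p: "p \<in> K"
      then have "\<ominus>\<^bsub>tensors\<^esub> p = - p"
        by (intro tensor_algebra_a_inv) (auto simp: K_def)
      with p T.a_inv_closed[of p] show "\<ominus>\<^bsub>tensors\<^esub> p \<in> K"
        by (simp add: K_def word_functional_uminus)
      fix q assume q: "q \<in> K"
      have "p + q \<in> carrier tensors"
        by (rule T.a_closed[of p q, unfolded tensor_algebra_add]) (use p q in \<open>simp_all add: K_def\<close>)
      with p q show "p \<oplus>\<^bsub>tensors\<^esub> q \<in> K"
        by (simp add: K_def word_functional_add)
    qed
  next
    fix p q assume p: "p \<in> K" and q: "q \<in> carrier tensors"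
    have c: "q * p \<in> carrier tensors" "p * q \<in> carrier tensors"
      by (rule T.m_closed[unfolded tensor_algebra_mult], use p q in \<open>simp_all add: K_def\<close>)+
    \<comment> \<open>Since \<open>u\<close> and \<open>v\<close> are arbitrary, the words of
      \<open>q\<close> can be absorbed into the context.\<close>
    have z: "word_functional (\<lambda>w. coord S (u @ w @ v)) p = 0" for u v
      using p by (simp add: K_def)
    have "word_functional (\<lambda>w. coord S (u @ w @ v)) (q * p) = 0" for u v
      unfolding word_functional_mult_left using z[of "u @ _" v] by simp
    with c show "q \<otimes>\<^bsub>tensors\<^esub> p \<in> K" by (simp add: K_def)
    have "word_functional (\<lambda>w. coord S (u @ w @ v)) (p * q) = 0" for u v
      unfolding word_functional_mult_right using z[of u "_ @ v"] by simp
    with c show "p \<otimes>\<^bsub>tensors\<^esub> q \<in> K" by (simp add: K_def)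
  qed
  moreover have "rels A \<subseteq> K"
  proof
    fix r assume r: "r \<in> rels A"
    have "word_functional (\<lambda>w. coord S (u @ w @ v)) r = 0" for u v
      unfolding coord_def
      by (rule word_functional_relation_eq_0[OF comm_sym finite_gens])
        (use r in \<open>auto simp: rels_eq\<close>)
    with r rels_subset show "r \<in> K" by (auto simp: K_def)
  qed
  ultimately have "p \<in> K"
    using assms T.genideal_minimal[of K "rels A"] by (auto simp: rel_ideal_def)
  then have "word_functional (\<lambda>w. coord S ([] @ w @ [])) p = 0"
    unfolding K_def by blast
  then show ?thesis by simp
qed

section \<open>Normal forms of words modulo the relations\<close>

lemma rel_ideal_single_mult:
  assumes "p \<in> rel_ideal A" "set u \<subseteq> gens A" "set v \<subseteq> gens A"
  shows "Poly_Mapping.single u c * p * Poly_Mapping.single v d \<in> rel_ideal A"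
  using assms by (intro rel_ideal_mult_left rel_ideal_mult_right) auto

text \<open>The word meets the symmetry conditions defining \<open>rels\<close>: either it is a
  square and equals its reversal, or it is read off by no commuting pair.\<close>

lemma vanishing_word_in_rel_ideal:
  assumes "a \<in> gens A" "b \<in> gens A" "a = b \<or> \<not> comm a b"
  shows "Poly_Mapping.single [a, b] 1 \<in> rel_ideal A"
proof -
  have "Poly_Mapping.single [a, b] (1::'f) \<in> tensor_power (gens A) 2"
    using assms by (simp add: tensor_power_def)
  moreover have "Poly_Mapping.lookup (Poly_Mapping.single [a, b] (1::'f)) [c, d] =
      Poly_Mapping.lookup (Poly_Mapping.single [a, b] 1) [d, c]" if "comm c d" for c d
  proof -
    have "[a, b] = [c, d] \<longleftrightarrow> [a, b] = [d, c]"
      using assms(3) that comm_sym[OF that] by blast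
    then show ?thesis by (simp only: lookup_single_if)
  qed
  ultimately have "Poly_Mapping.single [a, b] 1 \<in> rels A"
    unfolding rels_eq by blast
  then show ?thesis using rels_in_rel_ideal by blast
qed

text \<open>A symmetric tensor satisfies the conditions in \<open>rels_eq\<close> at every
  pair.\<close>

lemma anticommutator_in_rel_ideal:
  assumes "a \<in> gens A" "b \<in> gens A"
  shows "Poly_Mapping.single [a, b] 1 + Poly_Mapping.single [b, a] 1 \<in> rel_ideal A"
proof -
  have "Poly_Mapping.keys (Poly_Mapping.single [a, b] 1 + Poly_Mapping.single [b, a] (1::'f)) \<subseteq> {[a, b], [b, a]}"
    by (rule order.trans[OF Poly_Mapping.keys_add]) auto
  then have "Poly_Mapping.single [a, b] 1 + Poly_Mapping.single [b, a] (1::'f) \<in> tensor_power (gens A) 2"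
    using assms unfolding tensor_power_def by fastforce
  moreover have "Poly_Mapping.lookup (Poly_Mapping.single [a, b] 1 + Poly_Mapping.single [b, a] (1::'f)) [c, d] =
      Poly_Mapping.lookup (Poly_Mapping.single [a, b] 1 + Poly_Mapping.single [b, a] 1) [d, c]" for c d
  proof -
    have "[a, b] = [c, d] \<longleftrightarrow> [b, a] = [d, c]" "[b, a] = [c, d] \<longleftrightarrow> [a, b] = [d, c]"
      by blast+
    then show ?thesis by (simp only: lookup_add lookup_single_if add.commute)
  qed
  ultimately have "Poly_Mapping.single [a, b] 1 + Poly_Mapping.single [b, a] 1 \<in> rels A"
    unfolding rels_eq by blast
  then show ?thesis using rels_in_rel_ideal by blast
qed

text \<open>The letter \<open>a\<close> is moved to the right by anticommutators until it meets a
  letter that equals it or does not commute with it, where the two-letter product vanishes.\<close>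

lemma annihilated_word:
  assumes "set (a # w) \<subseteq> gens A" "\<exists>b\<in>set w. a = b \<or> \<not> comm a b"
  shows "Poly_Mapping.single (a # w) 1 \<in> rel_ideal A"
  using assms
proof (induction w)
  case (Cons b w)
  show ?case
  proof (cases "a = b \<or> \<not> comm a b")
    case True
    then have "Poly_Mapping.single [] 1 * Poly_Mapping.single [a, b] 1 * Poly_Mapping.single w 1 \<in> rel_ideal A"
      using Cons.prems by (intro rel_ideal_single_mult vanishing_word_in_rel_ideal) auto
    then show ?thesis by (simp add: single_mult_single)
  next
    case False
    then have "Poly_Mapping.single (a # w) 1 \<in> rel_ideal A"
      using Cons by auto
    \<comment> \<open>With the factor -1, adding this to \<open>(ab + ba)w\<close> cancels
      \<open>baw\<close> and leaves \<open>abw\<close>.\<close>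
    then have 1: "Poly_Mapping.single [b] (- 1) * Poly_Mapping.single (a # w) 1 * Poly_Mapping.single [] 1 \<in> rel_ideal A"
      using Cons.prems by (intro rel_ideal_single_mult) auto
    have "Poly_Mapping.single [] 1 * (Poly_Mapping.single [a, b] 1 + Poly_Mapping.single [b, a] 1)
        * Poly_Mapping.single w 1 \<in> rel_ideal A"
      using Cons.prems by (intro rel_ideal_single_mult anticommutator_in_rel_ideal) auto
    from rel_ideal_add[OF this 1] show ?thesis
      by (simp add: single_mult_single distrib_left distrib_right add.assoc flip: single_add)
  qed
qed simp

text \<open>On its way into the increasing word, \<open>a\<close> passes exactly the letters smaller
  than it, and each exchange costs a sign.\<close>

lemma insort_congruence:
  assumes "set (a # w) \<subseteq> gens A" "sorted w" "distinct w" "\<forall>b\<in>set w. a \<noteq> b"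
  shows "Poly_Mapping.single (a # w) 1
    - Poly_Mapping.single (insort a w) ((- 1) ^ card {b \<in> set w. b < a}) \<in> rel_ideal A"
  using assms
proof (induction w)
  case Nil
  then show ?case by (simp add: rel_ideal_zero)
next
  case (Cons b w)
  show ?case
  proof (cases "a < b")
    case True
    then have "{c \<in> set (b # w). c < a} = {}" using Cons.prems by auto
    moreover have "insort a (b # w) = a # b # w" using True by (simp add: less_imp_le)
    ultimately show ?thesis
      by (simp only: card.empty power_0 diff_self rel_ideal_zero)
  next
    case False
    let ?k = "card {c \<in> set w. c < a}"
    have ba: "b < a" using False Cons.prems by auto
    have "{c \<in> set (b # w). c < a} = insert b {c \<in> set w. c < a}"
      using ba by auto
    then have k: "card {c \<in> set (b # w). c < a} = Suc ?k"
      using Cons.prems by simp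
    \<comment> \<open>Minus \<open>b\<close> times the induction hypothesis replaces
      \<open>baw\<close> by \<open>b # insort a w\<close>; the factor -1 accounts for
      \<open>Suc ?k\<close>.\<close>
    have "Poly_Mapping.single [b] (- 1) * (Poly_Mapping.single (a # w) 1
        - Poly_Mapping.single (insort a w) ((- 1) ^ ?k)) * Poly_Mapping.single [] 1 \<in> rel_ideal A"
      using Cons by (intro rel_ideal_single_mult Cons.IH) auto
    moreover have "Poly_Mapping.single [] 1 * (Poly_Mapping.single [a, b] 1 + Poly_Mapping.single [b, a] 1)
        * Poly_Mapping.single w 1 \<in> rel_ideal A"
      using Cons.prems by (intro rel_ideal_single_mult anticommutator_in_rel_ideal) auto
    ultimately have "Poly_Mapping.single [] 1 * (Poly_Mapping.single [a, b] 1 + Poly_Mapping.single [b, a] 1)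
        * Poly_Mapping.single w 1 + Poly_Mapping.single [b] (- 1) * (Poly_Mapping.single (a # w) 1
        - Poly_Mapping.single (insort a w) ((- 1) ^ ?k)) * Poly_Mapping.single [] 1 \<in> rel_ideal A"
      by (rule rel_ideal_add[rotated])
    moreover have "insort a (b # w) = b # insort a w" using ba by auto
    ultimately show ?thesis
      unfolding k by (simp add: single_mult_single algebra_simps single_uminus)
  qed
qed

text \<open>The tail is sorted first and the head then inserted, in step with the recursion of
  \<open>exterior_sign\<close>. For a repeated letter the sorted word is shorter than
  \<open>w\<close>, but then its coefficient is 0.\<close>

lemma word_congruence:
  assumes "set w \<subseteq> gens A"
  shows "Poly_Mapping.single w 1
    - Poly_Mapping.single (sorted_list_of_set (set w)) (exterior_sign comm w) \<in> rel_ideal A"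
  using assms
proof (induction w)
  case Nil
  then show ?case by (simp add: rel_ideal_zero)
next
  case (Cons a w)
  let ?s = "sorted_list_of_set (set w)" and ?c = "exterior_sign comm w :: 'f"
  have "Poly_Mapping.single [a] 1 * (Poly_Mapping.single w 1 - Poly_Mapping.single ?s ?c)
      * Poly_Mapping.single [] 1 \<in> rel_ideal A"
    using Cons by (intro rel_ideal_single_mult Cons.IH) auto
  then have 1: "Poly_Mapping.single (a # w) 1 - Poly_Mapping.single (a # ?s) ?c \<in> rel_ideal A"
    by (simp add: single_mult_single right_diff_distrib)
  show ?case
  proof (cases "\<exists>b\<in>set w. a = b \<or> \<not> comm a b")
    case True
    \<comment> \<open>The sign of \<open>a # w\<close> is 0 here, so the whole word must lie in the
      ideal. As \<open>?s\<close> has the same letters as \<open>w\<close>, the word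
      \<open>a # ?s\<close> is annihilated.\<close>
    then have "Poly_Mapping.single [] ?c * Poly_Mapping.single (a # ?s) 1 * Poly_Mapping.single [] 1 \<in> rel_ideal A"
      using Cons.prems by (intro rel_ideal_single_mult annihilated_word) auto
    from rel_ideal_add[OF 1 this] True show ?thesis
      by (auto simp: single_mult_single)
  next
    case False
    let ?k = "card {b \<in> set w. b < a}"
    have "Poly_Mapping.single (a # ?s) 1
        - Poly_Mapping.single (insort a ?s) ((- 1) ^ card {b \<in> set ?s. b < a}) \<in> rel_ideal A"
      using Cons.prems False by (intro insort_congruence) auto
    then have "Poly_Mapping.single [] ?c * (Poly_Mapping.single (a # ?s) 1
        - Poly_Mapping.single (insort a ?s) ((- 1) ^ ?k)) * Poly_Mapping.single [] 1 \<in> rel_ideal A"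
      by (intro rel_ideal_single_mult) auto
    from rel_ideal_add[OF 1 this] show ?thesis
      using False by (auto simp: single_mult_single algebra_simps)
  qed
qed

end

subsection \<open>Dimension of the graded parts\<close>

lemma scalar_add: "scalar c + scalar d = scalar (c + d)"
  and scalar_uminus: "- scalar c = scalar (- c)"
  and scalar_mult: "scalar c * scalar d = scalar (c * d)"
  and scalar_one: "scalar 1 = 1"
  by (simp_all add: scalar_def single_add single_uminus single_mult_single)

lemma scalar_in_tensor_algebra [simp]: "scalar c \<in> carrier (tensor_algebra X)"
  by (simp add: scalar_def)

lemma scalar_eq_0_iff: "scalar c = 0 \<longleftrightarrow> c = 0"
  unfolding scalar_def by (metis lookup_single_eq lookup_zero single_zero)

text \<open>Stated for the free algebra, to be transported to the quotient along the residue
  homomorphism.\<close>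

lemma subfield_range_scalar:
  "subfield (range scalar) (tensor_algebra X :: ('x list \<Rightarrow>\<^sub>0 'f::field) ring)"
proof -
  let ?T = "tensor_algebra X :: ('x list \<Rightarrow>\<^sub>0 'f) ring"
  let ?K = "range scalar :: ('x list \<Rightarrow>\<^sub>0 'f) set"
  interpret ring ?T by (rule ring_tensor_algebra)
  have "subring ?K ?T"
  proof (rule subringI)
    show "\<one>\<^bsub>?T\<^esub> \<in> ?K" using scalar_one[symmetric] by auto
  next
    fix p assume "p \<in> ?K"
    then obtain c where "p = scalar c" by blast
    then show "\<ominus>\<^bsub>?T\<^esub> p \<in> ?K"
      by (simp add: tensor_algebra_a_inv scalar_uminus)
  qed (auto simp: scalar_add scalar_mult)
  then have "subcring ?K ?T"
    by (rule subcringI) (auto simp: scalar_mult mult.commute)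
  then show ?thesis
  proof (rule subfieldI)
    show "Units (?T\<lparr>carrier := ?K\<rparr>) = ?K - {\<zero>\<^bsub>?T\<^esub>}"
    proof
      show "Units (?T\<lparr>carrier := ?K\<rparr>) \<subseteq> ?K - {\<zero>\<^bsub>?T\<^esub>}"
        by (auto simp: Units_def)
      show "?K - {\<zero>\<^bsub>?T\<^esub>} \<subseteq> Units (?T\<lparr>carrier := ?K\<rparr>)"
      proof
        fix p assume "p \<in> ?K - {\<zero>\<^bsub>?T\<^esub>}"
        then obtain c where c: "p = scalar c" "c \<noteq> 0" by (auto simp: scalar_eq_0_iff)
        then have "scalar (inverse c) * p = 1" "p * scalar (inverse c) = 1"
          by (simp_all add: scalar_mult scalar_one)
        with c(1) show "p \<in> Units (?T\<lparr>carrier := ?K\<rparr>)"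
          unfolding Units_def by auto
      qed
    qed
  qed
qed

section \<open>A basis of each graded part\<close>

context partially_commuting_exterior
begin

abbreviation cliques :: "nat \<Rightarrow> 'x set set"
  where "cliques d \<equiv> {S. S \<subseteq> gens A \<and> card S = d \<and> pairwise comm S}"

lemma ring_hom_residue_class:
  "ring_hom_ring tensors (quadratic_algebra A) (residue_class A)"
proof -
  have "residue_class A = (\<lambda>p. rel_ideal A +>\<^bsub>tensors\<^esub> p)"
    by (rule ext) (simp add: residue_class_def)
  then show ?thesis
    unfolding quadratic_algebra_def using ideal.rcos_ring_hom_ring[OF ideal_rel_ideal] by simp
qed

sublocale residue: ring_hom_ring tensors "quadratic_algebra A" "residue_class A"
  by (rule ring_hom_residue_class)

lemma residue_class_eq_iff:
  assumes "p \<in> carrier tensors" "q \<in> carrier tensors"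
  shows "residue_class A p = residue_class A q \<longleftrightarrow> p - q \<in> rel_ideal A"
  using residue.R.quotient_eq_iff_same_a_r_cos[OF ideal_rel_ideal assms] assms(2)
  by (simp add: residue_class_def tensor_algebra_a_minus)

text \<open>A homomorphism carries a subfield to a subfield once 1 and 0 have distinct images. The
  coordinate of the empty set distinguishes them: it is 1 on the empty word and vanishes on the
  ideal.\<close>

lemma subfield_ground_field: "subfield (ground_field A) (quadratic_algebra A)"
proof -
  have "word_functional (coord {}) 1 = 1"
    using word_functional_single[of "coord {}" "[]" 1] by (simp add: coord_def)
  then have "1 - 0 \<notin> rel_ideal A"
    using word_functional_coord_rel_ideal[of 1 "{}"] by auto
  moreover have "1 \<in> carrier tensors"
    using residue.R.one_closed by simp
  ultimately have "residue_class A 1 \<noteq> residue_class A 0"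
    by (subst residue_class_eq_iff) auto
  moreover have "residue_class A 1 = \<one>\<^bsub>quadratic_algebra A\<^esub>"
    using residue.hom_one by simp
  moreover have "residue_class A 0 = \<zero>\<^bsub>quadratic_algebra A\<^esub>"
    using residue.hom_zero by simp
  ultimately show ?thesis
    unfolding ground_field_def
    using residue.img_is_subfield(2)[OF subfield_range_scalar] by metis
qed

text \<open>Each \<open>line_extension\<close> in \<open>Span\<close> adjoins the multiples of one
  more word.\<close>

lemma Span_words:
  assumes "\<forall>w\<in>set ws. set w \<subseteq> gens A"
  shows "residue.S.Span (ground_field A) (map (\<lambda>w. residue_class A (Poly_Mapping.single w 1)) ws)
    = residue_class A ` {p. Poly_Mapping.keys p \<subseteq> set ws}"
  using assms
proof (induction ws)
  case Nil
  have "{p. Poly_Mapping.keys p \<subseteq> {}} = {0 :: 'x list \<Rightarrow>\<^sub>0 'f}" by auto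
  then show ?case using residue.hom_zero by simp
next
  case (Cons w ws)
  have carr: "p \<in> carrier tensors" if "Poly_Mapping.keys p \<subseteq> set ws" for p :: "'x list \<Rightarrow>\<^sub>0 'f"
    using that Cons.prems by (auto simp: tensor_algebra_carrier_iff)
  have comb: "residue_class A (scalar c) \<otimes>\<^bsub>quadratic_algebra A\<^esub> residue_class A (Poly_Mapping.single w 1)
      \<oplus>\<^bsub>quadratic_algebra A\<^esub> residue_class A p = residue_class A (Poly_Mapping.single w c + p)"
    if "Poly_Mapping.keys p \<subseteq> set ws" for c p
  proof -
    have w: "Poly_Mapping.single w 1 \<in> carrier tensors" "Poly_Mapping.single w c \<in> carrier tensors"
      using Cons.prems by simp_all
    have "residue_class A (scalar c) \<otimes>\<^bsub>quadratic_algebra A\<^esub> residue_class A (Poly_Mapping.single w 1)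
        = residue_class A (Poly_Mapping.single w c)"
      using residue.hom_mult[of "scalar c" "Poly_Mapping.single w 1"] w
      by (simp add: scalar_def single_mult_single)
    then show ?thesis
      using residue.hom_add[OF w(2) carr[OF that]] by simp
  qed
  have "residue.S.Span (ground_field A) (map (\<lambda>w. residue_class A (Poly_Mapping.single w 1)) (w # ws))
    = residue.S.line_extension (ground_field A) (residue_class A (Poly_Mapping.single w 1))
        (residue_class A ` {p. Poly_Mapping.keys p \<subseteq> set ws})"
    using Cons by simp
  also have "\<dots> = residue_class A ` {p. Poly_Mapping.keys p \<subseteq> set (w # ws)}"
  proof (intro equalityI subsetI)
    fix x
    assume "x \<in> residue.S.line_extension (ground_field A) (residue_class A (Poly_Mapping.single w 1))
        (residue_class A ` {p. Poly_Mapping.keys p \<subseteq> set ws})"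
    then obtain c p where p: "Poly_Mapping.keys p \<subseteq> set ws"
      and x: "x = residue_class A (Poly_Mapping.single w c + p)"
      unfolding residue.S.line_extension_mem_iff ground_field_def using comb by auto
    have "Poly_Mapping.keys (Poly_Mapping.single w c + p) \<subseteq> set (w # ws)"
      using Poly_Mapping.keys_add[of "Poly_Mapping.single w c" p] p
      by (auto split: if_splits)
    with x show "x \<in> residue_class A ` {p. Poly_Mapping.keys p \<subseteq> set (w # ws)}" by blast
  next
    fix x assume "x \<in> residue_class A ` {p. Poly_Mapping.keys p \<subseteq> set (w # ws)}"
    then obtain p where p: "Poly_Mapping.keys p \<subseteq> set (w # ws)" "x = residue_class A p" by blast
    \<comment> \<open>Splitting off the term at \<open>w\<close> leaves an element supported on
      \<open>ws\<close>.\<close>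
    let ?c = "Poly_Mapping.lookup p w"
    let ?q = "p - Poly_Mapping.single w ?c"
    have q: "Poly_Mapping.keys ?q \<subseteq> set ws"
    proof
      fix v assume "v \<in> Poly_Mapping.keys ?q"
      then have "Poly_Mapping.lookup p v - (if w = v then ?c else 0) \<noteq> 0"
        by (simp only: in_keys_iff lookup_minus lookup_single_if) simp
      then have "v \<noteq> w" "Poly_Mapping.lookup p v \<noteq> 0" by (auto split: if_splits)
      then show "v \<in> set ws" using p(1) by (auto simp: in_keys_iff)
    qed
    have "x = residue_class A (scalar ?c) \<otimes>\<^bsub>quadratic_algebra A\<^esub> residue_class A (Poly_Mapping.single w 1)
        \<oplus>\<^bsub>quadratic_algebra A\<^esub> residue_class A ?q"
      using comb[OF q, of ?c] p(2) by simp
    with q show "x \<in> residue.S.line_extension (ground_field A) (residue_class A (Poly_Mapping.single w 1))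
        (residue_class A ` {p. Poly_Mapping.keys p \<subseteq> set ws})"
      unfolding residue.S.line_extension_mem_iff ground_field_def by blast
  qed
  finally show ?case .
qed

text \<open>An increasing word is determined by its letter set, so \<open>coord (set w)\<close> is 1
  on \<open>w\<close> and 0 on the other words. As it kills the ideal, no class of a word lies in
  the span of the later ones.\<close>

lemma independent_words:
  assumes "distinct ws"
    and "\<forall>w\<in>set ws. set w \<subseteq> gens A \<and> sorted w \<and> distinct w \<and> pairwise comm (set w)"
  shows "residue.S.independent (ground_field A) (map (\<lambda>w. residue_class A (Poly_Mapping.single w 1)) ws)"
  using assms
proof (induction ws)
  case (Cons w ws)
  have w: "Poly_Mapping.single w 1 \<in> carrier tensors"
    using Cons.prems by simp
  have "residue_class A (Poly_Mapping.single w 1)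
      \<notin> residue.S.Span (ground_field A) (map (\<lambda>w. residue_class A (Poly_Mapping.single w 1)) ws)"
  proof
    assume "residue_class A (Poly_Mapping.single w 1)
      \<in> residue.S.Span (ground_field A) (map (\<lambda>w. residue_class A (Poly_Mapping.single w 1)) ws)"
    then obtain p where p: "Poly_Mapping.keys p \<subseteq> set ws"
      and eq: "residue_class A (Poly_Mapping.single w 1) = residue_class A p"
      using Span_words[of ws] Cons.prems by auto
    have "p \<in> carrier tensors"
      using p Cons.prems by (auto simp: tensor_algebra_carrier_iff)
    with eq w have "Poly_Mapping.single w 1 - p \<in> rel_ideal A"
      by (simp add: residue_class_eq_iff)
    from word_functional_coord_rel_ideal[OF this, of "set w"]
    have "coord (set w) w = word_functional (coord (set w)) p"
      by (simp add: word_functional_diff)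
    also have "\<dots> = 0"
      unfolding word_functional_def
    proof (rule sum.neutral, rule ballI)
      fix v assume "v \<in> Poly_Mapping.keys p"
      then have "v \<in> set ws" using p by blast
      with Cons.prems have "set v \<noteq> set w"
        using sorted_distinct_set_unique[of v w] by auto
      then show "Poly_Mapping.lookup p v * coord (set w) v = 0"
        by (simp add: coord_def)
    qed
    finally show False
      using exterior_sign_sorted[of comm w, where ?'f = 'f] comm_sym Cons.prems by (simp add: coord_def)
  qed
  with Cons w show ?case
    by (auto intro: residue.S.independent.intros)
qed simp

text \<open>Replacing words by their normal forms reaches every class of degree
  \<open>d\<close>.\<close>

lemma graded_part_eq:
  "graded_part A d = residue_class A ` {p. Poly_Mapping.keys p \<subseteq> sorted_list_of_set ` cliques d}"
proof
  have fin: "finite S" if "S \<subseteq> gens A" for S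
    using finite_subset[OF that finite_gens] .
  have "set w \<subseteq> gens A \<and> length w = d" if "w \<in> sorted_list_of_set ` cliques d" for w
    using that fin by auto
  then have "{p. Poly_Mapping.keys p \<subseteq> sorted_list_of_set ` cliques d} \<subseteq> tensor_power (gens A) d"
    unfolding tensor_power_def by blast
  then show "residue_class A ` {p. Poly_Mapping.keys p \<subseteq> sorted_list_of_set ` cliques d} \<subseteq> graded_part A d"
    unfolding graded_part_def by (rule image_mono)
next
  show "graded_part A d \<subseteq> residue_class A ` {p. Poly_Mapping.keys p \<subseteq> sorted_list_of_set ` cliques d}"
  proof
    fix x assume "x \<in> graded_part A d"
    then obtain p where p: "p \<in> tensor_power (gens A) d" "x = residue_class A p"
      by (auto simp: graded_part_def)
    \<comment> \<open>The normal form of \<open>p\<close>, taken term by term.\<close>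
    let ?n = "\<lambda>w. Poly_Mapping.single (sorted_list_of_set (set w)) (Poly_Mapping.lookup p w * exterior_sign comm w)"
    define q where "q = (\<Sum>w\<in>Poly_Mapping.keys p. ?n w)"
    \<comment> \<open>A nonzero sign forces \<open>w\<close> to have \<open>d\<close> distinct,
      pairwise commuting letters; all other terms vanish.\<close>
    have "Poly_Mapping.keys (?n w) \<subseteq> sorted_list_of_set ` cliques d" if "w \<in> Poly_Mapping.keys p" for w
    proof (cases "exterior_sign comm w = (0::'f)")
      case False
      then have "distinct w" "pairwise comm (set w)"
        using exterior_sign_nonzero[of comm w, where ?'f = 'f] comm_sym by blast+
      then have "set w \<in> cliques d"
        using p(1) that by (auto simp: tensor_power_def distinct_card)
      then show ?thesis by auto
    qed simp
    then have q: "Poly_Mapping.keys q \<subseteq> sorted_list_of_set ` cliques d"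
      unfolding q_def by (intro order.trans[OF Poly_Mapping.keys_sum]) blast
    have "Poly_Mapping.single w (Poly_Mapping.lookup p w) - ?n w \<in> rel_ideal A"
      if "w \<in> Poly_Mapping.keys p" for w
    proof -
      have "Poly_Mapping.single [] (Poly_Mapping.lookup p w) * (Poly_Mapping.single w 1
          - Poly_Mapping.single (sorted_list_of_set (set w)) (exterior_sign comm w)) * Poly_Mapping.single [] 1 \<in> rel_ideal A"
        using p(1) that by (intro rel_ideal_single_mult word_congruence) (auto simp: tensor_power_def)
      then show ?thesis by (simp add: single_mult_single right_diff_distrib)
    qed
    then have "(\<Sum>w\<in>Poly_Mapping.keys p. Poly_Mapping.single w (Poly_Mapping.lookup p w) - ?n w) \<in> rel_ideal A"
      by (rule rel_ideal_sum)
    then have "p - q \<in> rel_ideal A"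
      unfolding q_def sum_subtractf by (simp only: poly_mapping_sum_single[symmetric])
    moreover have pc: "p \<in> carrier tensors"
      using p(1) by (auto simp: tensor_algebra_carrier_iff tensor_power_def)
    moreover have "q \<in> carrier tensors"
    proof -
      have "set w \<subseteq> gens A" if "w \<in> sorted_list_of_set ` cliques d" for w
        using that finite_subset[OF _ finite_gens] by auto
      then show ?thesis
        using q unfolding tensor_algebra_carrier_iff by blast
    qed
    ultimately have "x = residue_class A q"
      using p(2) by (simp add: residue_class_eq_iff)
    with q show "x \<in> residue_class A ` {p. Poly_Mapping.keys p \<subseteq> sorted_list_of_set ` cliques d}"
      by blast
  qed
qed

text \<open>The increasing words on cliques give a basis: they span by \<open>graded_part_eq\<close>
  and \<open>Span_words\<close> and are independent by \<open>independent_words\<close>.\<close>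

theorem hilbert_coeff_eq_card_cliques: "hilbert_coeff A d = card (cliques d)"
proof -
  have fin: "finite S" if "S \<in> cliques d" for S
    using that finite_subset[OF _ finite_gens] by blast
  have "finite (cliques d)"
    by (rule finite_subset[of _ "Pow (gens A)"]) (use finite_gens in auto)
  then obtain ws where ws: "set ws = sorted_list_of_set ` cliques d" "distinct ws"
    using finite_distinct_list[of "sorted_list_of_set ` cliques d"] by auto
  have words: "\<forall>w\<in>set ws. set w \<subseteq> gens A \<and> sorted w \<and> distinct w \<and> pairwise comm (set w)"
    unfolding ws(1) using fin by auto
  have "residue.S.dimension (length ws) (ground_field A) (graded_part A d)"
    using residue.S.dimension_independent[OF independent_words[OF ws(2) words]] Span_words[of ws] words
    by (simp add: graded_part_eq ws(1))
  moreover have "length ws = card (cliques d)"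
  proof -
    have "inj_on sorted_list_of_set (cliques d)"
      by (rule inj_onI) (metis fin sorted_list_of_set.set_sorted_key_list_of_set)
    then show ?thesis
      using distinct_card[OF ws(2)] by (simp add: ws(1) card_image)
  qed
  ultimately show ?thesis
    unfolding hilbert_coeff_def
    using residue.S.dimI[OF subfield_ground_field] by (simp add: over_def)
qed

end

subsection \<open>Commuting sets of generators of a path\<close>

text \<open>Increasing words presuppose a linear order; this one runs along the path as
  \<open>V 1 < E 1 < V 2 < E 2 < ...\<close>.\<close>

instantiation path_gen :: linorder
begin

fun path_gen_code :: "path_gen \<Rightarrow> nat" where
  "path_gen_code (V i) = 2 * i"
| "path_gen_code (E i) = 2 * i + 1"

definition less_eq_path_gen :: "path_gen \<Rightarrow> path_gen \<Rightarrow> bool"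
  where "less_eq_path_gen a b \<longleftrightarrow> path_gen_code a \<le> path_gen_code b"

definition less_path_gen :: "path_gen \<Rightarrow> path_gen \<Rightarrow> bool"
  where "less_path_gen a b \<longleftrightarrow> path_gen_code a < path_gen_code b"

instance
proof
  fix a b :: path_gen
  assume "a \<le> b" "b \<le> a"
  then have "path_gen_code a = path_gen_code b" by (simp add: less_eq_path_gen_def)
  then show "a = b" by (cases a; cases b; simp; presburger)
qed (auto simp: less_eq_path_gen_def less_path_gen_def)

end

lemma V_in_path_gens [simp]: "V i \<in> path_gens n \<longleftrightarrow> 1 \<le> i \<and> i \<le> n"
  and E_in_path_gens [simp]: "E i \<in> path_gens n \<longleftrightarrow> 1 \<le> i \<and> Suc i \<le> n"
  by (auto simp: path_gens_def)

lemma path_gens_0: "path_gens 0 = {}"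
  and path_gens_1: "path_gens (Suc 0) = {V (Suc 0)}"
  by (auto simp: path_gens_def)

lemma path_gens_Suc_Suc:
  "path_gens (Suc (Suc n)) = insert (V (Suc (Suc n))) (insert (E (Suc n)) (path_gens (Suc n)))"
  by (auto simp: path_gens_def)

lemma finite_path_gens [simp]: "finite (path_gens n)"
  by (induction n rule: induct_nat_012) (simp_all add: path_gens_0 path_gens_1 path_gens_Suc_Suc)

lemma path_gens_mono: "path_gens n \<subseteq> path_gens (Suc n)"
  by (auto simp: path_gens_def)

lemma commuting_sym: "commuting a b \<Longrightarrow> commuting b a"
  by (cases a; cases b) auto

section \<open>The dual of the path algebra\<close>

lemma lookup_scalar_mult:
  "Poly_Mapping.lookup (scalar c * p) w = c * Poly_Mapping.lookup p w"
proof -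
  have "scalar c * p = Poly_Mapping.map ((*) c) p"
    by (simp add: mult_map_scale_conv_mult scalar_def zero_list_def)
  then show ?thesis by (simp add: map.rep_eq when_def)
qed

text \<open>Makes annihilating a commutator the same as the symmetry condition in
  \<open>partially_commuting_exterior\<close>.\<close>

lemma pairing_commutator:
  "pairing s (Poly_Mapping.single v 1 - Poly_Mapping.single w 1)
    = Poly_Mapping.lookup s v - Poly_Mapping.lookup s w"
proof -
  have "pairing s (Poly_Mapping.single u 1) = Poly_Mapping.lookup s u" for u
    by (simp add: pairing_def lookup_single_if in_keys_iff if_distrib[of "\<lambda>x. _ * x"] cong: if_cong)
  then show ?thesis
    by (simp add: pairing_def lookup_minus right_diff_distrib sum_subtractf)
qed

text \<open>The elements annihilated by \<open>s\<close> form a subspace, so a spanning set suffices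
  as a test.\<close>

lemma annihilates_span_iff:
  fixes s :: "'x list \<Rightarrow>\<^sub>0 'f::field"
  shows "(\<forall>r\<in>module.span (\<lambda>c p. scalar c * p) B. pairing s r = 0) \<longleftrightarrow> (\<forall>r\<in>B. pairing s r = 0)"
proof -
  interpret vector_space "\<lambda>(c::'f) (p :: 'x list \<Rightarrow>\<^sub>0 'f). scalar c * p"
    by (rule vector_space_scalar)
  have "subspace {r. pairing s r = 0}"
    by (rule subspaceI)
      (simp_all add: pairing_def lookup_add lookup_scalar_mult distrib_left sum.distrib
        mult.left_commute[of _ "_::'f"] flip: sum_distrib_left)
  then show ?thesis
    using span_minimal[of B "{r. pairing s r = 0}"] span_superset[of B] by blast
qed

lemma partially_commuting_exterior_ch_path:
  "partially_commuting_exterior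
    (quadratic_dual (ch_path n :: (path_gen, 'f::field) quadratic_data)) commuting"
proof
  let ?A = "quadratic_dual (ch_path n :: (path_gen, 'f) quadratic_data)"
  show "finite (gens ?A)"
    by (simp add: quadratic_dual_def ch_path_def)
  show "commuting a b \<Longrightarrow> commuting b a" for a b
    by (rule commuting_sym)
  show "rels ?A = {s \<in> tensor_power (gens ?A) 2. \<forall>a\<in>gens ?A. \<forall>b\<in>gens ?A.
      commuting a b \<longrightarrow> Poly_Mapping.lookup s [a, b] = Poly_Mapping.lookup s [b, a]}"
  proof -
    have "(\<forall>r\<in>{Poly_Mapping.single [a, b] 1 - Poly_Mapping.single [b, a] 1 |a b.
          a \<in> path_gens n \<and> b \<in> path_gens n \<and> commuting a b}. pairing s r = 0) \<longleftrightarrow>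
        (\<forall>a\<in>path_gens n. \<forall>b\<in>path_gens n. commuting a b \<longrightarrow>
          pairing s (Poly_Mapping.single [a, b] 1 - Poly_Mapping.single [b, a] 1) = 0)"
      for s :: "path_gen list \<Rightarrow>\<^sub>0 'f"
      by blast
    then show ?thesis
      unfolding quadratic_dual_def ch_path_def quadratic_data.simps annihilates_span_iff
      by (simp only: pairing_commutator right_minus_eq)
  qed
qed

section \<open>The clique polynomial of a path and its recurrence\<close>

definition path_cliques :: "nat \<Rightarrow> path_gen set set"
  where "path_cliques n = {S. S \<subseteq> path_gens n \<and> pairwise commuting S}"

definition clique_poly :: "nat \<Rightarrow> rat fps"
  where "clique_poly n = (\<Sum>S\<in>path_cliques n. fps_X ^ card S)"

lemma finite_path_cliques [simp]: "finite (path_cliques n)"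
  by (rule finite_subset[of _ "Pow (path_gens n)"]) (auto simp: path_cliques_def)

text \<open>Grouping the cliques by size turns the sum into the counts of
  \<open>hilbert_coeff_eq_card_cliques\<close>.\<close>

lemma hilbert_series_ch_path:
  "hilbert_series (quadratic_dual (ch_path n :: (path_gen, 'f::field) quadratic_data)) = clique_poly n"
proof (rule fps_ext)
  fix d
  let ?A = "quadratic_dual (ch_path n :: (path_gen, 'f) quadratic_data)"
  have "hilbert_coeff ?A d = card {S \<in> path_cliques n. card S = d}"
    unfolding partially_commuting_exterior.hilbert_coeff_eq_card_cliques[OF partially_commuting_exterior_ch_path]
    by (rule arg_cong[of _ _ card]) (auto simp: path_cliques_def quadratic_dual_def ch_path_def)
  moreover have "fps_nth (clique_poly n) d = (\<Sum>S\<in>path_cliques n. if card S = d then 1 else 0)"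
    unfolding clique_poly_def fps_sum_nth by (intro sum.cong) auto
  ultimately show "fps_nth (hilbert_series ?A) d = fps_nth (clique_poly n) d"
    by (simp add: hilbert_series_def sum.If_cases Int_def)
qed

lemma clique_poly_0: "clique_poly 0 = 1"
proof -
  have "path_cliques 0 = {{}}" by (auto simp: path_cliques_def path_gens_0)
  then show ?thesis by (simp add: clique_poly_def)
qed

lemma clique_poly_1: "clique_poly (Suc 0) = 1 + fps_X"
proof -
  have "path_cliques (Suc 0) = {{}, {V (Suc 0)}}"
    by (auto simp: path_cliques_def path_gens_1 pairwise_def)
  then show ?thesis by (simp add: clique_poly_def)
qed

text \<open>In the longer path, \<open>V (n+2)\<close> fails to commute only with
  \<open>E (n+1)\<close>, whereas \<open>E (n+1)\<close> also fails to commute with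
  \<open>V (n+1)\<close> and, if present, \<open>E n\<close>. A clique containing
  \<open>E (n+1)\<close> thus lies otherwise in the path with two vertices fewer.\<close>

lemma path_cliques_Suc_Suc:
  "path_cliques (Suc (Suc n)) = path_cliques (Suc n) \<union> insert (V (Suc (Suc n))) ` path_cliques (Suc n)
    \<union> insert (E (Suc n)) ` path_cliques n"
proof (intro equalityI subsetI)
  let ?v = "V (Suc (Suc n))" and ?e = "E (Suc n)"
  fix S assume "S \<in> path_cliques (Suc (Suc n))"
  then have S: "S \<subseteq> insert ?v (insert ?e (path_gens (Suc n)))" "pairwise commuting S"
    by (auto simp: path_cliques_def path_gens_Suc_Suc)
  have diff: "pairwise commuting (S - B)" for B
    using S(2) by (rule pairwise_subset) auto
  consider "?e \<in> S" | "?e \<notin> S" "?v \<in> S" | "?e \<notin> S" "?v \<notin> S" by blast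
  then show "S \<in> path_cliques (Suc n) \<union> insert ?v ` path_cliques (Suc n) \<union> insert ?e ` path_cliques n"
  proof cases
    case 1
    have "x \<in> path_gens n" if "x \<in> S - {?e}" for x
    proof -
      \<comment> \<open>This rules out \<open>?v\<close>, \<open>V (Suc n)\<close> and
        \<open>E n\<close>, and what remains is \<open>path_gens n\<close>.\<close>
      have "commuting x ?e" using S(2) that 1 by (auto simp: pairwise_def)
      moreover have "x \<in> insert ?v (path_gens (Suc n))" using S(1) that by blast
      ultimately show ?thesis by (cases x) auto
    qed
    then have "S - {?e} \<in> path_cliques n" using diff by (auto simp: path_cliques_def)
    moreover have "S = insert ?e (S - {?e})" using 1 by blast
    ultimately show ?thesis by blast
  next
    case 2
    then have "S - {?v} \<in> path_cliques (Suc n)" using S(1) diff by (auto simp: path_cliques_def)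
    moreover have "S = insert ?v (S - {?v})" using 2 by blast
    ultimately show ?thesis by blast
  next
    case 3
    then show ?thesis using S by (auto simp: path_cliques_def)
  qed
next
  let ?v = "V (Suc (Suc n))" and ?e = "E (Suc n)"
  fix S assume "S \<in> path_cliques (Suc n) \<union> insert ?v ` path_cliques (Suc n) \<union> insert ?e ` path_cliques n"
  moreover have "commuting x ?v \<and> commuting ?v x" if "x \<in> path_gens (Suc n)" for x
    using that by (cases x) auto
  moreover have "commuting x ?e \<and> commuting ?e x" if "x \<in> path_gens n" for x
    using that by (cases x) auto
  ultimately show "S \<in> path_cliques (Suc (Suc n))"
    using path_gens_mono[of n] by (auto simp: path_cliques_def path_gens_Suc_Suc pairwise_insert subset_iff)
qed

text \<open>Inserting a new generator raises the size by one, whence the factor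
  \<open>fps_X\<close>; the three families are told apart by membership of \<open>?v\<close> and
  \<open>?e\<close>.\<close>

lemma clique_poly_Suc_Suc:
  "clique_poly (Suc (Suc n)) = clique_poly (Suc n) + fps_X * clique_poly (Suc n) + fps_X * clique_poly n"
proof -
  let ?v = "V (Suc (Suc n))" and ?e = "E (Suc n)"
  have fin: "finite S" if "S \<in> path_cliques m" for S m
    using that finite_subset[OF _ finite_path_gens] by (auto simp: path_cliques_def)
  have insert_sum: "(\<Sum>S\<in>insert a ` path_cliques m. fps_X ^ card S) = fps_X * clique_poly m"
    if "a \<notin> path_gens m" for a m
  proof -
    have a: "a \<notin> S" if "S \<in> path_cliques m" for S
      using that \<open>a \<notin> path_gens m\<close> by (auto simp: path_cliques_def)
    then have "inj_on (insert a) (path_cliques m)"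
      by (intro inj_onI) (metis insert_ident)
    then show ?thesis
      using a fin by (simp add: sum.reindex clique_poly_def sum_distrib_left)
  qed
  have nv: "?v \<notin> S" if "S \<in> path_cliques (Suc n) \<union> insert ?e ` path_cliques n" for S
    using that by (auto simp: path_cliques_def)
  have ne: "?e \<notin> S" if "S \<in> path_cliques (Suc n)" for S
    using that by (auto simp: path_cliques_def)
  have disj: "path_cliques (Suc n) \<inter> insert ?v ` path_cliques (Suc n) = {}"
    "(path_cliques (Suc n) \<union> insert ?v ` path_cliques (Suc n)) \<inter> insert ?e ` path_cliques n = {}"
    using nv ne by blast+
  have "clique_poly (Suc (Suc n)) = (\<Sum>S\<in>path_cliques (Suc n). fps_X ^ card S)
      + (\<Sum>S\<in>insert ?v ` path_cliques (Suc n). fps_X ^ card S)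
      + (\<Sum>S\<in>insert ?e ` path_cliques n. fps_X ^ card S)"
    unfolding clique_poly_def path_cliques_Suc_Suc
    by (simp add: sum.union_disjoint disj)
  then show ?thesis
    by (simp add: insert_sum clique_poly_def[of "Suc n", symmetric])
qed

text \<open>
  Stated without assuming a division ring, since the coefficients in the theorem are themselves
  power series.
\<close>

lemma fps_one_divide_eqI:
  fixes f g :: "'a::{comm_ring_1, inverse} fps"
  assumes "g * f = 1" "fps_nth f 0 = 1" "inverse (1::'a) = 1"
  shows "1 / f = g"
proof -
  have f: "subdegree f = 0"
    using assms(2) by (simp add: subdegree_eq_0_iff)
  \<comment> \<open>Matches the constant coefficient of \<open>g\<close> with the value
    \<open>inverse 1 = 1\<close> from which \<open>inverse f\<close> is built.\<close>
  have "fps_nth g 0 = 1"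
    using arg_cong[OF assms(1), of "\<lambda>h. fps_nth h 0"] assms(2) by simp
  then have "inverse f = g"
    using fps_lr_inverse_unique_ring1(2)[of f g] assms by (simp add: fps_inverse_def mult.commute)
  then show ?thesis by (simp add: fps_divide_def f)
qed

theorem proposition7p3:
  shows "Abs_fps (\<lambda>n. hilbert_series (quadratic_dual (ch_path n :: (path_gen, 'f::field) quadratic_data)))
    = (let t = fps_X; x = fps_const fps_X in 1 / (1 - t - x * t - x * t ^ 2))"
proof -
  define F where "F = Abs_fps clique_poly"
  let ?x = "fps_const fps_X :: rat fps fps"
  \<comment> \<open>This equation encodes the recurrence. At \<open>n = 1\<close> the last summand
    contributes nothing, since it starts in degree 2, and \<open>1 + fps_X\<close> comes from the
    two summands before it.\<close>
  have "F = 1 + fps_X * F + ?x * (fps_X * F) + ?x * (fps_X ^ 2 * F)"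
  proof (rule fps_ext)
    fix n
    consider "n = 0" | "n = Suc 0" | m where "n = Suc (Suc m)"
      by (metis not0_implies_Suc)
    then show "fps_nth F n = fps_nth (1 + fps_X * F + ?x * (fps_X * F) + ?x * (fps_X ^ 2 * F)) n"
      by cases (simp_all add: F_def clique_poly_0 clique_poly_1 clique_poly_Suc_Suc fps_X_power_mult_nth)
  qed
  then have "F * (1 - fps_X - ?x * fps_X - ?x * fps_X ^ 2) = 1"
    by (simp add: algebra_simps)
  then have "1 / (1 - fps_X - ?x * fps_X - ?x * fps_X ^ 2) = F"
    by (rule fps_one_divide_eqI) simp_all
  then show ?thesis
    by (simp add: F_def hilbert_series_ch_path Let_def)
qed

end
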